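(* Let $d\ge 2$ be an integer. (1) If a rational map of degree $d$ admits an imaginary reflection as an antiholomorphic automorphism, then $d$ must be odd. (2) Let $d$ be odd and let $\phi$ be a rational map of degree $d$. Then $\phi$ admits an imaginary reflection $\tau$ as an automorphism if and only if it can be conjugated (by a Möbius transformation) to a rational map of the form $$z\mapsto\dfrac{\sum_{k=0}^{d} a_{k} z^{k}}{\sum_{k=0}^{d} (-1)^{k}\,\overline{a_{d-k}}\, z^{k}}\in\mathrm{Rat}_d,$$ with $a_0,\dots,a_d\in\mathbb{C}$, where under the conjugation $\tau$ corresponds to $\tau_1(z)=-1/\overline z$.
   Context: $\mathrm{Rat}_d$ is the space of complex rational maps of degree (exactly) $d\ge 2$. An extended Möbius transformation is a map $Q=T\circ J$ with $T\in\mathrm{PSL}_2(\mathbb{C})$ and $J(z)=\overline z$; it is an antiholomorphic automorphism of $\phi$ if $Q\circ\phi\circ Q^{-1}=\phi$. An imaginary reflection is an extended Möbius transformation of order two without fixed points on $\widehat{\mathbb{C}}$. *)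

theory Defs
  imports Complex_Main "HOL-Computational_Algebra.Computational_Algebra"
begin

datatype sphere = Pt complex | Infty

text \<open>The point \<open>[u : v]\<close> of the projective line. Meant for \<open>(u, v) \<noteq> (0, 0)\<close>.\<close>

definition proj_pt :: "complex \<Rightarrow> complex \<Rightarrow> sphere" where
  "proj_pt u v = (if v = 0 then Infty else Pt (u / v))"

text \<open>
  The map \<open>p / q\<close> on the sphere, intended for coprime \<open>p\<close> and \<open>q\<close>. The value at infinity is the
  quotient of the coefficients in degree \<open>max (deg p) (deg q)\<close>.
\<close>

fun rat_eval :: "complex poly \<Rightarrow> complex poly \<Rightarrow> sphere \<Rightarrow> sphere" where
  "rat_eval p q (Pt z) = proj_pt (poly p z) (poly q z)"
| "rat_eval p q Infty =
     (let m = max (degree p) (degree q) in proj_pt (coeff p m) (coeff q m))"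

text \<open>\<open>f\<close> is the map \<open>p / q\<close>, the fraction is in lowest terms, and its degree is exactly \<open>d\<close>.\<close>

definition is_rat_quotient ::
    "nat \<Rightarrow> complex poly \<Rightarrow> complex poly \<Rightarrow> (sphere \<Rightarrow> sphere) \<Rightarrow> bool" where
  "is_rat_quotient d p q f \<longleftrightarrow>
     coprime p q \<and> max (degree p) (degree q) = d \<and> f = rat_eval p q"

definition Rat :: "nat \<Rightarrow> (sphere \<Rightarrow> sphere) set" where
  "Rat d = {f. \<exists>p q. is_rat_quotient d p q f}"

fun moebius_map :: "complex \<Rightarrow> complex \<Rightarrow> complex \<Rightarrow> complex \<Rightarrow> sphere \<Rightarrow> sphere" where
  "moebius_map a b c d (Pt z) = proj_pt (a * z + b) (c * z + d)"
| "moebius_map a b c d Infty = proj_pt a c"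

text \<open>The elements of PSL(2, C), as transformations of the sphere.\<close>

definition Moebius :: "(sphere \<Rightarrow> sphere) set" where
  "Moebius = {moebius_map a b c d | a b c d. a * d - b * c = 1}"

fun conj_map :: "sphere \<Rightarrow> sphere" where
  "conj_map (Pt z) = Pt (cnj z)"
| "conj_map Infty = Infty"

definition Ext_Moebius :: "(sphere \<Rightarrow> sphere) set" where
  "Ext_Moebius = {T \<circ> conj_map | T. T \<in> Moebius}"

lemma moebius_map_comp:
  assumes "a * d - b * c = 1"
  shows "moebius_map d (- b) (- c) a (moebius_map a b c d x) = x"
proof (cases x)
  case (Pt z)
  show ?thesis
  proof (cases "c * z + d = 0")
    case True
    then have "c \<noteq> 0" using assms by (auto simp: algebra_simps)
    then have "z = - d / c" using True by (simp add: field_simps eq_neg_iff_add_eq_0)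
    then show ?thesis using Pt True \<open>c \<noteq> 0\<close> by (simp add: proj_pt_def)
  next
    case False
    have 1: "a - c * (a * z + b) / (c * z + d) = 1 / (c * z + d)"
      using False assms by (simp add: field_simps)
    have 2: "d * ((a * z + b) / (c * z + d)) - b = z / (c * z + d)"
    proof -
      have "d * (a * z + b) - b * (c * z + d) = (a * d - b * c) * z" by (simp add: algebra_simps)
      then show ?thesis using False assms by (simp add: field_simps)
    qed
    show ?thesis using Pt False 1 2 by (simp add: proj_pt_def)
  qed
next
  case Infty
  then show ?thesis using assms by (auto simp: proj_pt_def field_simps)
qed

lemma bij_Moebius:
  assumes "T \<in> Moebius"
  shows "bij T"
proof -
  from assms obtain a b c d where T: "T = moebius_map a b c d" and det: "a * d - b * c = 1"
    by (auto simp: Moebius_def)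
  have det': "d * a - (- b) * (- c) = 1" using det by (simp add: algebra_simps)
  show ?thesis unfolding T
    by (rule o_bij[where g = "moebius_map d (- b) (- c) a"])
      (use moebius_map_comp[OF det] moebius_map_comp[OF det'] in auto)
qed

lemma bij_Ext_Moebius:
  assumes "Q \<in> Ext_Moebius"
  shows "bij Q"
proof -
  have inv: "conj_map (conj_map x) = x" for x by (cases x) auto
  have "bij conj_map" by (rule o_bij[where g = conj_map]) (auto simp: inv)
  then show ?thesis using assms bij_Moebius by (auto simp: Ext_Moebius_def intro: bij_comp)
qed

text \<open>Meant for bijective \<open>g\<close>.\<close>

definition conjugate_by :: "(sphere \<Rightarrow> sphere) \<Rightarrow> (sphere \<Rightarrow> sphere) \<Rightarrow> sphere \<Rightarrow> sphere" where
  "conjugate_by g f = g \<circ> f \<circ> inv g"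

definition antihol_automorphism :: "(sphere \<Rightarrow> sphere) \<Rightarrow> (sphere \<Rightarrow> sphere) \<Rightarrow> bool" where
  "antihol_automorphism Q f \<longleftrightarrow> Q \<in> Ext_Moebius \<and> conjugate_by Q f = f"

definition imaginary_reflection :: "(sphere \<Rightarrow> sphere) \<Rightarrow> bool" where
  "imaginary_reflection Q \<longleftrightarrow>
     Q \<in> Ext_Moebius \<and> Q \<noteq> id \<and> Q \<circ> Q = id \<and> (\<forall>x. Q x \<noteq> x)"

fun tau1 :: "sphere \<Rightarrow> sphere" where
  "tau1 (Pt z) = (if z = 0 then Infty else Pt (- 1 / cnj z))"
| "tau1 Infty = Pt 0"

lemma imaginary_reflection_tau1: "imaginary_reflection tau1"
proof -
  have "tau1 = moebius_map 0 (- 1) 1 0 \<circ> conj_map"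
  proof
    fix x show "tau1 x = (moebius_map 0 (- 1) 1 0 \<circ> conj_map) x"
      by (cases x) (auto simp: proj_pt_def)
  qed
  moreover have "moebius_map 0 (- 1) 1 0 \<in> Moebius"
    unfolding Moebius_def by force
  ultimately have 1: "tau1 \<in> Ext_Moebius" by (auto simp: Ext_Moebius_def)
  have 2: "tau1 (tau1 x) = x" for x by (cases x) auto
  have 3: "tau1 x \<noteq> x" for x
  proof (cases x)
    case (Pt z)
    have "- 1 / cnj z \<noteq> z" if "z \<noteq> 0"
    proof
      assume "- 1 / cnj z = z"
      then have "z * cnj z = - 1" using that by (simp add: field_simps)
      then have "complex_of_real ((cmod z)\<^sup>2) = of_real (- 1)"
        using complex_norm_square[of z] by simp
      then have "(cmod z)\<^sup>2 = - 1" by (simp only: of_real_eq_iff)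
      then show False using zero_le_power2[of "cmod z"] by linarith
    qed
    then show ?thesis using Pt by auto
  qed auto
  have "tau1 \<noteq> id" using 3[of Infty] by (metis id_apply)
  then show ?thesis using 1 2 3 by (auto simp: imaginary_reflection_def)
qed

definition nf_num :: "nat \<Rightarrow> (nat \<Rightarrow> complex) \<Rightarrow> complex poly" where
  "nf_num d a = (\<Sum>k\<le>d. monom (a k) k)"

definition nf_den :: "nat \<Rightarrow> (nat \<Rightarrow> complex) \<Rightarrow> complex poly" where
  "nf_den d a = (\<Sum>k\<le>d. monom ((- 1) ^ k * cnj (a (d - k))) k)"

definition normal_form :: "nat \<Rightarrow> (sphere \<Rightarrow> sphere) \<Rightarrow> bool" where
  "normal_form d f \<longleftrightarrow> (\<exists>a. is_rat_quotient d (nf_num d a) (nf_den d a) f)"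

end

theory Submission
  imports Defs "HOL-Computational_Algebra.Field_as_Ring"
begin

text \<open>
  The proof rests on two facts. First, all imaginary reflections are conjugate: if \<open>\<tau>\<close> exchanges
  \<open>\<infinity>\<close> with a point \<open>w\<close>, then in the coordinate \<open>\<zeta> = z - w\<close> it reads \<open>\<zeta> \<mapsto> - 1 / (K * cnj \<zeta>)\<close>; being an
  involution makes \<open>K\<close> real, having no fixed point makes \<open>K\<close> positive, and rescaling \<open>\<zeta>\<close> by
  \<open>sqrt K\<close> turns \<open>\<tau>\<close> into \<open>tau1\<close> (lemma \<open>imaginary_reflection_conjugate_tau1\<close>). So everything
  reduces to the rational maps that commute with \<open>tau1\<close>.

  Second, \<open>tau1\<close> is induced by the antilinear map \<open>(u, v) \<mapsto> (cnj v, - cnj u)\<close>, whose square is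
  \<open>- 1\<close> and not \<open>1\<close>. Composing a binary form of degree \<open>d\<close> with it and conjugating the value gives
  the operator \<open>twist d\<close>, whose square is therefore \<open>(- 1) ^ d\<close>. If \<open>p / q\<close> in lowest terms commutes
  with \<open>tau1\<close>, then \<open>twist d q = l p\<close> and \<open>twist d p = - l q\<close> for a constant \<open>l\<close>. Twisting once more
  yields \<open>(- 1) ^ d = - (cmod l)\<^sup>2\<close>, so \<open>d\<close> is odd and \<open>l\<close> is unimodular. Multiplying \<open>p\<close> and \<open>q\<close>
  by a common unimodular constant then yields \<open>q = twist d p\<close>, and this equation, read off on
  coefficients, is the normal form (lemma \<open>commutes_tau1_imp_normal_form\<close>).

  Binary forms also serve to show that conjugation by a Moebius transformation preserves
  \<open>Rat d\<close>: in homogeneous coordinates the point at infinity needs no separate treatment, and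
  being in lowest terms with degree exactly \<open>d\<close> means having no common zero.
\<close>

section \<open>Homogeneous coordinates\<close>

text \<open>
  The binary form of degree \<open>d\<close> with dehomogenization \<open>p\<close>. The degree is a parameter of its own,
  since numerator and denominator have to be homogenized to the same degree.
\<close>

definition hom_form :: "nat \<Rightarrow> complex poly \<Rightarrow> complex \<Rightarrow> complex \<Rightarrow> complex" where
  "hom_form d p u v = (\<Sum>k\<le>d. coeff p k * u ^ k * v ^ (d - k))"

text \<open>
  The notion \<open>is_rat_quotient\<close> in homogeneous coordinates: one nonvanishing condition on the
  projective line encodes both coprimality (at finite points) and exactness of the degree
  (at infinity).
\<close>

definition represents ::
    "nat \<Rightarrow> complex poly \<Rightarrow> complex poly \<Rightarrow> (sphere \<Rightarrow> sphere) \<Rightarrow> bool" where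
  "represents d p q f \<longleftrightarrow> degree p \<le> d \<and> degree q \<le> d \<and>
     (\<forall>u v. (u, v) \<noteq> (0, 0) \<longrightarrow>
        (hom_form d p u v, hom_form d q u v) \<noteq> (0, 0) \<and>
        f (proj_pt u v) = proj_pt (hom_form d p u v) (hom_form d q u v))"

lemma sphere_proj_ptE:
  obtains u v where "x = proj_pt u v" "(u, v) \<noteq> (0, 0)"
proof (cases x)
  case (Pt z)
  then show ?thesis using that[of z 1] by (simp add: proj_pt_def)
next
  case Infty
  then show ?thesis using that[of 1 0] by (simp add: proj_pt_def)
qed

lemma sphere_map_eqI:
  assumes "\<And>u v. (u, v) \<noteq> (0, 0) \<Longrightarrow> f (proj_pt u v) = g (proj_pt u v)"
  shows "f = g"
proof
  fix x show "f x = g x" by (rule sphere_proj_ptE[of x]) (use assms in auto)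
qed

lemma proj_pt_eq_iff:
  assumes "(u, v) \<noteq> (0, 0)" "(u', v') \<noteq> (0, 0)"
  shows "proj_pt u v = proj_pt u' v' \<longleftrightarrow> u * v' = u' * v"
  using assms by (auto simp: proj_pt_def field_simps)

lemma proj_pt_scale: "c \<noteq> 0 \<Longrightarrow> proj_pt (c * u) (c * v) = proj_pt u v"
  by (simp add: proj_pt_def)

lemma hom_form_finite:
  assumes "degree p \<le> d" "v \<noteq> 0"
  shows "hom_form d p u v = v ^ d * poly p (u / v)"
proof -
  have "poly p (u / v) = (\<Sum>k\<le>d. coeff p k * (u / v) ^ k)"
    by (subst poly_as_sum_of_monoms'[OF assms(1), symmetric]) (simp add: poly_sum poly_monom)
  then show ?thesis unfolding hom_form_def
    by (auto simp: sum_distrib_left power_divide power_diff assms(2) field_simps intro!: sum.cong)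
qed

lemma hom_form_infinite: "hom_form d p u 0 = coeff p d * u ^ d"
proof -
  have "hom_form d p u 0 = (\<Sum>k\<le>d. if k = d then coeff p d * u ^ d else 0)"
    unfolding hom_form_def by (rule sum.cong) (auto simp: power_0_left)
  then show ?thesis by simp
qed

lemma hom_form_add: "hom_form d (p + q) u v = hom_form d p u v + hom_form d q u v"
  by (simp add: hom_form_def sum.distrib algebra_simps)

lemma hom_form_smult: "hom_form d (smult c p) u v = c * hom_form d p u v"
  by (simp add: hom_form_def sum_distrib_left algebra_simps)

lemma hom_form_sum: "hom_form d (\<Sum>k\<in>A. F k) u v = (\<Sum>k\<in>A. hom_form d (F k) u v)"
  by (induction A rule: infinite_finite_induct) (simp_all add: hom_form_add, simp_all add: hom_form_def)

lemma coeff_mult_at_bound: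
  fixes p q :: "complex poly"
  assumes "degree p \<le> m" "degree q \<le> n"
  shows "coeff (p * q) (m + n) = coeff p m * coeff q n"
proof (cases "degree p = m \<and> degree q = n")
  case True
  then show ?thesis using coeff_mult_degree_sum[of p q] by auto
next
  case False
  then have "degree p + degree q < m + n" using assms by auto
  then have "coeff (p * q) (m + n) = 0"
    using degree_mult_le[of p q] by (intro coeff_eq_0) linarith
  moreover have "coeff p m = 0 \<or> coeff q n = 0"
    using False assms by (metis coeff_eq_0 le_neq_implies_less)
  ultimately show ?thesis by auto
qed

text \<open>
  Forms multiply like polynomials. This makes the value of a substituted form computable at
  infinity, where it is a leading coefficient, without expanding anything.
\<close>

lemma hom_form_mult:
  assumes "degree p \<le> m" "degree q \<le> n"
  shows "hom_form (m + n) (p * q) u v = hom_form m p u v * hom_form n q u v"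
proof (cases "v = 0")
  case True
  then show ?thesis using coeff_mult_at_bound[OF assms]
    by (simp add: hom_form_infinite power_add)
next
  case False
  have "degree (p * q) \<le> m + n" using degree_mult_le[of p q] assms by linarith
  then show ?thesis using False assms by (simp add: hom_form_finite power_add)
qed

lemma hom_form_power:
  assumes "degree p \<le> 1"
  shows "hom_form k (p ^ k) u v = hom_form 1 p u v ^ k"
proof (induction k)
  case 0
  show ?case by (simp add: hom_form_def)
next
  case (Suc k)
  have "degree (p ^ k) \<le> k" using degree_power_le[of p k] assms
    by (metis le_trans mult.commute mult_le_mono2 mult.right_neutral)
  then show ?case using hom_form_mult[OF assms, of "p ^ k" k u v] Suc by simp
qed

text \<open>
  By the fundamental theorem of algebra, a nonconstant common divisor would have a root.
\<close>

lemma coprime_iff_no_common_root: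
  fixes p q :: "complex poly"
  shows "coprime p q \<longleftrightarrow> (\<forall>z. poly p z \<noteq> 0 \<or> poly q z \<noteq> 0)"
proof
  assume cop: "coprime p q"
  show "\<forall>z. poly p z \<noteq> 0 \<or> poly q z \<noteq> 0"
  proof (rule ccontr)
    assume "\<not> ?thesis"
    then obtain z where "[:- z, 1:] dvd p" "[:- z, 1:] dvd q" by (auto simp: poly_eq_0_iff_dvd)
    then have "is_unit [:- z, 1:]" using cop coprime_common_divisor by blast
    then show False by (auto simp: is_unit_iff_degree)
  qed
next
  assume *: "\<forall>z. poly p z \<noteq> 0 \<or> poly q z \<noteq> 0"
  show "coprime p q"
  proof (rule coprimeI)
    fix c assume c: "c dvd p" "c dvd q"
    have nz: "poly c z \<noteq> 0" for z using * c by (metis dvd_trans poly_eq_0_iff_dvd)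
    then have "constant (poly c)" using fundamental_theorem_of_algebra by blast
    then have "degree c = 0" by (simp add: constant_degree)
    moreover have "c \<noteq> 0" using nz by auto
    ultimately show "is_unit c" by (simp add: is_unit_iff_degree)
  qed
qed

lemma is_rat_quotient_iff_represents: "is_rat_quotient d p q f \<longleftrightarrow> represents d p q f"
proof
  assume "is_rat_quotient d p q f"
  then have cop: "coprime p q" and deg: "max (degree p) (degree q) = d" and f: "f = rat_eval p q"
    by (auto simp: is_rat_quotient_def)
  have degs: "degree p \<le> d" "degree q \<le> d" using deg by auto
  have top: "coeff p d \<noteq> 0 \<or> coeff q d \<noteq> 0"
  proof (rule ccontr)
    assume zero: "\<not> ?thesis"
    have "degree p = d \<or> degree q = d" using deg by linarith
    then have "d = 0" using zero by (metis degree_0 leading_coeff_0_iff)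
    then have "p = 0 \<and> q = 0" using zero degs by (metis le_zero_eq leading_coeff_0_iff)
    then show False using cop by simp
  qed
  have "(hom_form d p u v, hom_form d q u v) \<noteq> (0, 0) \<and>
        f (proj_pt u v) = proj_pt (hom_form d p u v) (hom_form d q u v)"
    if "(u, v) \<noteq> (0, 0)" for u v
  proof (cases "v = 0")
    case True
    then have "u ^ d \<noteq> 0" using that by auto
    then show ?thesis using True top
      by (simp add: hom_form_infinite f proj_pt_def deg)
  next
    case False
    then have "v ^ d \<noteq> 0" by auto
    then show ?thesis using False cop
      by (simp add: hom_form_finite degs f proj_pt_scale coprime_iff_no_common_root)
         (simp add: proj_pt_def)
  qed
  then show "represents d p q f" using degs by (auto simp: represents_def)
next
  assume r: "represents d p q f"
  then have degs: "degree p \<le> d" "degree q \<le> d" by (auto simp: represents_def)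
  have nz: "(hom_form d p u v, hom_form d q u v) \<noteq> (0, 0)"
    and f: "f (proj_pt u v) = proj_pt (hom_form d p u v) (hom_form d q u v)"
    if "(u, v) \<noteq> (0, 0)" for u v using r that by (auto simp: represents_def)
  have fin: "hom_form d p z 1 = poly p z" "hom_form d q z 1 = poly q z" for z
    by (simp_all add: hom_form_finite degs)
  have inf: "hom_form d p 1 0 = coeff p d" "hom_form d q 1 0 = coeff q d"
    by (simp_all add: hom_form_infinite)
  have cop: "coprime p q" unfolding coprime_iff_no_common_root
  proof
    fix z show "poly p z \<noteq> 0 \<or> poly q z \<noteq> 0" using nz[of z 1] fin by auto
  qed
  have "coeff p d \<noteq> 0 \<or> coeff q d \<noteq> 0" using nz[of 1 0] inf by auto
  then have deg: "max (degree p) (degree q) = d" using degs le_degree[of p d] le_degree[of q d] by auto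
  have "f = rat_eval p q"
  proof
    fix x show "f x = rat_eval p q x"
    proof (cases x)
      case (Pt z)
      then show ?thesis using f[of z 1] fin by (simp add: proj_pt_def)
    next
      case Infty
      then show ?thesis using f[of 1 0] inf deg by (simp add: proj_pt_def)
    qed
  qed
  then show "is_rat_quotient d p q f" using cop deg by (simp add: is_rat_quotient_def)
qed

section \<open>The Moebius group acting on rational maps\<close>

text \<open>
  The determinant condition lets one recover \<open>(u, v)\<close> from its image by Cramer's rule.
\<close>

lemma linear_image_nonzero:
  fixes a b c e u v :: complex
  assumes "a * e - b * c = 1" "(u, v) \<noteq> (0, 0)"
  shows "(a * u + b * v, c * u + e * v) \<noteq> (0, 0)"
proof
  assume "(a * u + b * v, c * u + e * v) = (0, 0)"
  then have "a * u + b * v = 0" "c * u + e * v = 0" by auto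
  moreover have "u = (a * e - b * c) * u" "v = (a * e - b * c) * v" using assms(1) by auto
  then have "u = e * (a * u + b * v) - b * (c * u + e * v)"
    "v = a * (c * u + e * v) - c * (a * u + b * v)" by (simp_all add: algebra_simps)
  ultimately show False using assms(2) by auto
qed

text \<open>
  The matrix acts linearly on homogeneous coordinates, so composition of transformations is
  multiplication of matrices.
\<close>

lemma moebius_map_proj_pt:
  assumes "a * e - b * c = 1" "(u, v) \<noteq> (0, 0)"
  shows "moebius_map a b c e (proj_pt u v) = proj_pt (a * u + b * v) (c * u + e * v)"
proof (cases "v = 0")
  case True
  then show ?thesis using assms(2) proj_pt_scale[of u a c] by (simp add: proj_pt_def mult.commute)
next
  case False
  then show ?thesis
    using proj_pt_scale[of v "a * (u / v) + b" "c * (u / v) + e"]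
    by (simp add: proj_pt_def[of u v] algebra_simps)
qed

lemma conj_map_proj_pt: "conj_map (proj_pt u v) = proj_pt (cnj u) (cnj v)"
  by (simp add: proj_pt_def)

lemma Moebius_comp:
  assumes "S \<in> Moebius" "T \<in> Moebius"
  shows "S \<circ> T \<in> Moebius"
proof -
  obtain a b c e where S: "S = moebius_map a b c e" and dS: "a * e - b * c = 1"
    using assms(1) by (auto simp: Moebius_def)
  obtain a' b' c' e' where T: "T = moebius_map a' b' c' e'" and dT: "a' * e' - b' * c' = 1"
    using assms(2) by (auto simp: Moebius_def)
  have "(a * a' + b * c') * (c * b' + e * e') - (a * b' + b * e') * (c * a' + e * c')
      = (a * e - b * c) * (a' * e' - b' * c')" by (simp add: algebra_simps)
  then have det: "(a * a' + b * c') * (c * b' + e * e') - (a * b' + b * e') * (c * a' + e * c') = 1"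
    using dS dT by simp
  have "S \<circ> T = moebius_map (a * a' + b * c') (a * b' + b * e') (c * a' + e * c') (c * b' + e * e')"
  proof (rule sphere_map_eqI)
    fix u v :: complex assume uv: "(u, v) \<noteq> (0, 0)"
    have "(S \<circ> T) (proj_pt u v)
        = proj_pt (a * (a' * u + b' * v) + b * (c' * u + e' * v))
                  (c * (a' * u + b' * v) + e * (c' * u + e' * v))"
      unfolding S T o_apply moebius_map_proj_pt[OF dT uv]
      by (rule moebius_map_proj_pt[OF dS linear_image_nonzero[OF dT uv]])
    then show "(S \<circ> T) (proj_pt u v) = moebius_map (a * a' + b * c') (a * b' + b * e')
        (c * a' + e * c') (c * b' + e * e') (proj_pt u v)"
      unfolding moebius_map_proj_pt[OF det uv] by (simp add: algebra_simps)
  qed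
  then show ?thesis using det by (auto simp: Moebius_def)
qed

lemma Moebius_inv:
  assumes "T \<in> Moebius"
  shows "inv T \<in> Moebius"
proof -
  obtain a b c e where T: "T = moebius_map a b c e" and det: "a * e - b * c = 1"
    using assms by (auto simp: Moebius_def)
  have det': "e * a - (- b) * (- c) = 1" using det by (simp add: algebra_simps)
  have "inv T = moebius_map e (- b) (- c) a"
    unfolding T by (rule inv_equality) (use moebius_map_comp[OF det] moebius_map_comp[OF det'] in auto)
  then show ?thesis using det' unfolding Moebius_def by blast
qed

lemma Ext_Moebius_comp_left: "S \<in> Moebius \<Longrightarrow> Q \<in> Ext_Moebius \<Longrightarrow> S \<circ> Q \<in> Ext_Moebius"
  unfolding Ext_Moebius_def using Moebius_comp by (auto simp: comp_assoc[symmetric])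

text \<open>
  Complex conjugation can be moved past a Moebius transformation by conjugating its coefficients.
\<close>

lemma Ext_Moebius_comp_right:
  assumes "Q \<in> Ext_Moebius" "S \<in> Moebius"
  shows "Q \<circ> S \<in> Ext_Moebius"
proof -
  obtain T where T: "T \<in> Moebius" "Q = T \<circ> conj_map" using assms(1) by (auto simp: Ext_Moebius_def)
  obtain a b c e where S: "S = moebius_map a b c e" and det: "a * e - b * c = 1"
    using assms(2) by (auto simp: Moebius_def)
  have det': "cnj a * cnj e - cnj b * cnj c = 1"
    using arg_cong[OF det, of cnj] by simp
  have "conj_map \<circ> S = moebius_map (cnj a) (cnj b) (cnj c) (cnj e) \<circ> conj_map"
    by (rule sphere_map_eqI) (simp add: S moebius_map_proj_pt det det' conj_map_proj_pt)
  then have "Q \<circ> S = (T \<circ> moebius_map (cnj a) (cnj b) (cnj c) (cnj e)) \<circ> conj_map"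
    using T(2) by (simp add: comp_assoc)
  moreover have "T \<circ> moebius_map (cnj a) (cnj b) (cnj c) (cnj e) \<in> Moebius"
    using T(1) det' by (intro Moebius_comp) (auto simp: Moebius_def)
  ultimately show ?thesis by (auto simp: Ext_Moebius_def)
qed

lemma Rat_postcomp:
  assumes "T \<in> Moebius" "\<phi> \<in> Rat d"
  shows "T \<circ> \<phi> \<in> Rat d"
proof -
  obtain a b c e where T: "T = moebius_map a b c e" and det: "a * e - b * c = 1"
    using assms(1) by (auto simp: Moebius_def)
  obtain p q where r: "represents d p q \<phi>"
    using assms(2) by (auto simp: Rat_def is_rat_quotient_iff_represents)
  have "represents d (smult a p + smult b q) (smult c p + smult e q) (T \<circ> \<phi>)"
    unfolding represents_def
  proof (intro conjI allI impI)
    show "degree (smult a p + smult b q) \<le> d" "degree (smult c p + smult e q) \<le> d"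
      using r by (auto simp: represents_def intro!: degree_add_le order_trans[OF degree_smult_le])
  next
    fix u v :: complex assume "(u, v) \<noteq> (0, 0)"
    then have nz: "(hom_form d p u v, hom_form d q u v) \<noteq> (0, 0)"
      and f: "\<phi> (proj_pt u v) = proj_pt (hom_form d p u v) (hom_form d q u v)"
      using r by (auto simp: represents_def)
    show "(hom_form d (smult a p + smult b q) u v, hom_form d (smult c p + smult e q) u v) \<noteq> (0, 0)"
      using linear_image_nonzero[OF det nz] by (simp add: hom_form_add hom_form_smult)
    show "(T \<circ> \<phi>) (proj_pt u v) = proj_pt (hom_form d (smult a p + smult b q) u v)
            (hom_form d (smult c p + smult e q) u v)"
      using moebius_map_proj_pt[OF det nz] by (simp add: hom_form_add hom_form_smult f T)
  qed
  then show ?thesis by (auto simp: Rat_def is_rat_quotient_iff_represents)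
qed

text \<open>
  A form composed with a linear map of the plane is again a form of the same degree: substitute
  the two linear forms into each monomial.
\<close>

lemma linear_substitution:
  obtains p' where "degree p' \<le> d"
    "\<And>u v. hom_form d p' u v = hom_form d p (a * u + b * v) (c * u + e * v)"
proof
  let ?p = "\<Sum>k\<le>d. smult (coeff p k) ([:b, a:] ^ k * [:e, c:] ^ (d - k))"
  have lin: "degree [:b, a:] \<le> 1" "degree [:e, c:] \<le> 1" by auto
  have pow: "degree ([:b, a:] ^ k) \<le> k" "degree ([:e, c:] ^ k) \<le> k" for k
    using degree_power_le[of "[:b, a:]" k] degree_power_le[of "[:e, c:]" k]
    by (auto split: if_splits)
  show "degree ?p \<le> d"
  proof (rule degree_sum_le)
    fix k assume k: "k \<in> {..d}"
    have "degree ([:b, a:] ^ k * [:e, c:] ^ (d - k)) \<le> k + (d - k)"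
      using degree_mult_le add_mono[OF pow] by (rule order_trans)
    then show "degree (smult (coeff p k) ([:b, a:] ^ k * [:e, c:] ^ (d - k))) \<le> d"
      using k by (intro order_trans[OF degree_smult_le]) auto
  qed auto
  fix u v
  have one: "hom_form 1 [:b, a:] u v = a * u + b * v" "hom_form 1 [:e, c:] u v = c * u + e * v"
    by (simp_all add: hom_form_def)
  have "hom_form d ([:b, a:] ^ k * [:e, c:] ^ (d - k)) u v
      = (a * u + b * v) ^ k * (c * u + e * v) ^ (d - k)" if "k \<le> d" for k
    using hom_form_mult[OF pow, of k "d - k" u v] that
    by (simp only: hom_form_power[OF lin(1)] hom_form_power[OF lin(2)] one le_add_diff_inverse)
  then show "hom_form d ?p u v = hom_form d p (a * u + b * v) (c * u + e * v)"
    by (simp add: hom_form_sum hom_form_smult)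
       (simp add: hom_form_def mult.assoc)
qed

lemma Rat_precomp:
  assumes "T \<in> Moebius" "\<phi> \<in> Rat d"
  shows "\<phi> \<circ> T \<in> Rat d"
proof -
  obtain a b c e where T: "T = moebius_map a b c e" and det: "a * e - b * c = 1"
    using assms(1) by (auto simp: Moebius_def)
  obtain p q where r: "represents d p q \<phi>"
    using assms(2) by (auto simp: Rat_def is_rat_quotient_iff_represents)
  obtain p' where p': "degree p' \<le> d"
    "\<And>u v. hom_form d p' u v = hom_form d p (a * u + b * v) (c * u + e * v)"
    using linear_substitution[of d p a b c e] by blast
  obtain q' where q': "degree q' \<le> d"
    "\<And>u v. hom_form d q' u v = hom_form d q (a * u + b * v) (c * u + e * v)"
    using linear_substitution[of d q a b c e] by blast
  have "represents d p' q' (\<phi> \<circ> T)"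
    unfolding represents_def
  proof (intro conjI allI impI p'(1) q'(1))
    fix u v :: complex assume uv: "(u, v) \<noteq> (0, 0)"
    note im = linear_image_nonzero[OF det uv]
    show "(hom_form d p' u v, hom_form d q' u v) \<noteq> (0, 0)"
      using r im unfolding represents_def p'(2) q'(2) by blast
    show "(\<phi> \<circ> T) (proj_pt u v) = proj_pt (hom_form d p' u v) (hom_form d q' u v)"
      using r im unfolding represents_def p'(2) q'(2) T o_apply moebius_map_proj_pt[OF det uv]
      by blast
  qed
  then show ?thesis by (auto simp: Rat_def is_rat_quotient_iff_represents)
qed

lemma Rat_conjugate_by: "T \<in> Moebius \<Longrightarrow> \<phi> \<in> Rat d \<Longrightarrow> conjugate_by T \<phi> \<in> Rat d"
  unfolding conjugate_by_def by (intro Rat_precomp Rat_postcomp Moebius_inv)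

section \<open>Conjugation\<close>

lemma conjugate_by_eq_iff:
  assumes "bij g"
  shows "conjugate_by g f = h \<longleftrightarrow> g \<circ> f = h \<circ> g"
proof
  assume "conjugate_by g f = h"
  then have h: "h = conjugate_by g f" by simp
  show "g \<circ> f = h \<circ> g"
    using assms by (simp add: h conjugate_by_def fun_eq_iff bij_is_inj)
next
  assume "g \<circ> f = h \<circ> g"
  then have "conjugate_by g f = h \<circ> (g \<circ> inv g)" by (simp add: conjugate_by_def comp_assoc)
  then show "conjugate_by g f = h" using assms by (simp add: bij_is_surj surj_iff[THEN iffD1])
qed

text \<open>
  Conjugating a map together with its symmetry by the same \<open>T\<close> does not change whether they commute.
\<close>

lemma conjugation_preserves_commuting:
  assumes "bij T" "bij Q" "bij R" "conjugate_by T Q = R"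
  shows "conjugate_by R (conjugate_by T f) = conjugate_by T f \<longleftrightarrow> conjugate_by Q f = f"
proof -
  have TQ: "T (Q x) = R (T x)" for x
    using assms(4) conjugate_by_eq_iff[OF assms(1)] by (metis comp_apply)
  have Tf: "conjugate_by T f (T x) = T (f x)" for x
    using assms(1) by (simp add: conjugate_by_def bij_is_inj)
  have "R \<circ> conjugate_by T f = conjugate_by T f \<circ> R \<longleftrightarrow>
      (\<forall>x. R (conjugate_by T f (T x)) = conjugate_by T f (R (T x)))"
    using assms(1) by (auto simp: fun_eq_iff) (metis bij_pointE)
  also have "\<dots> \<longleftrightarrow> (\<forall>x. T (Q (f x)) = T (f (Q x)))"
    by (simp only: TQ[symmetric] Tf)
  also have "\<dots> \<longleftrightarrow> Q \<circ> f = f \<circ> Q"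
    using assms(1) by (auto simp: fun_eq_iff bij_def inj_eq)
  finally show ?thesis using assms(2,3) by (simp add: conjugate_by_eq_iff)
qed

section \<open>Imaginary reflections form a single conjugacy class\<close>

lemma bij_tau1: "bij tau1"
  using imaginary_reflection_tau1 bij_Ext_Moebius by (auto simp: imaginary_reflection_def)

text \<open>
  The reflection exchanges \<open>\<infinity>\<close> and \<open>w = a / c\<close>; placing \<open>w\<close> at the origin leaves a single
  coefficient \<open>c\<^sup>2\<close>. It is real because the reflection is an involution, and it is positive because
  for negative \<open>c\<^sup>2\<close> the circle of radius \<open>sqrt (- 1 / c\<^sup>2)\<close> about \<open>w\<close> would be fixed pointwise.
  The conjugating map is \<open>z \<mapsto> sqrt (c\<^sup>2) * (z - w)\<close>.
\<close>

lemma imaginary_reflection_conjugate_tau1: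
  assumes "imaginary_reflection \<tau>"
  obtains T where "T \<in> Moebius" "conjugate_by T \<tau> = tau1"
proof -
  from assms obtain a b c e where tau: "\<tau> = moebius_map a b c e \<circ> conj_map"
    and det: "a * e - b * c = 1"
    by (auto simp: imaginary_reflection_def Ext_Moebius_def Moebius_def)
  have invol: "\<tau> (\<tau> x) = x" and nofix: "\<tau> x \<noteq> x" for x
    using assms by (auto simp: imaginary_reflection_def fun_eq_iff)
  have c: "c \<noteq> 0" using nofix[of Infty] by (auto simp: tau proj_pt_def)
  define w where "w = a / c"
  have tau_inf: "\<tau> Infty = Pt w" using c by (simp add: tau proj_pt_def w_def)
  have "\<tau> (Pt w) = Infty" using invol[of Infty] tau_inf by simp
  then have "c * cnj w + e = 0" by (simp add: tau proj_pt_def split: if_splits)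
  then have e: "e = - c * cnj w" by (simp add: eq_neg_iff_add_eq_0 add.commute)
  have tau_fin: "\<tau> (Pt (w + z)) = (if z = 0 then Infty else Pt (w - 1 / (c\<^sup>2 * cnj z)))" for z
  proof -
    have den: "c * cnj (w + z) + e = c * cnj z" by (simp add: e algebra_simps)
    have "c * (a * cnj (w + z) + b) = a * (c * cnj (w + z) + e) - (a * e - b * c)"
      by (simp add: algebra_simps)
    then have "c * (a * cnj (w + z) + b) = a * c * cnj z - 1"
      by (simp only: den det mult.assoc)
    then have num: "a * cnj (w + z) + b = (a * c * cnj z - 1) / c" using c by (simp add: field_simps)
    show ?thesis using c
      by (simp add: tau proj_pt_def den num del: complex_cnj_add)
         (simp add: w_def field_simps power2_eq_square)
  qed
  \<comment> \<open>Applying the reflection twice to \<open>w + 1\<close> already shows that \<open>c\<^sup>2\<close> is real.\<close>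
  define X where "X = c\<^sup>2 * cnj (- 1 / c\<^sup>2)"
  have X: "w - 1 / X = w + 1" unfolding X_def
    using invol[of "Pt (w + 1)"] tau_fin[of 1] tau_fin[of "- 1 / c\<^sup>2"] c by simp
  have "1 / X = w - (w - 1 / X)" by simp
  also have "\<dots> = - 1" unfolding X by simp
  finally have "X = - 1" by (metis div_by_1 divide_divide_eq_right minus_divide_right mult_1)
  then have "c\<^sup>2 / cnj (c\<^sup>2) = 1" by (simp add: X_def)
  then have "cnj (c\<^sup>2) = c\<^sup>2" using c by (metis divide_eq_1_iff)
  then obtain r where r: "c\<^sup>2 = complex_of_real r" by (metis Reals_cases Reals_cnj_iff)
  have r0: "r \<noteq> 0" using r c by auto
  have "r > 0"
  proof (rule ccontr)
    assume "\<not> r > 0"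
    \<comment> \<open>The point \<open>w + z\<close> on that circle would be fixed.\<close>
    define z where "z = complex_of_real (sqrt (- 1 / r))"
    have neg: "- 1 / r > 0" using r0 \<open>\<not> r > 0\<close> by (simp add: field_simps)
    then have z0: "z \<noteq> 0" by (simp add: z_def)
    have "z * z = complex_of_real (- 1 / r)"
      using neg unfolding z_def of_real_mult[symmetric] by simp
    then have "c\<^sup>2 * (z * z) = - 1" using r0 unfolding r of_real_mult[symmetric]
      by simp
    then have "- 1 / (c\<^sup>2 * cnj z) = z" using z0 c by (simp add: z_def field_simps)
    then have "\<tau> (Pt (w + z)) = Pt (w + z)" using tau_fin[of z] z0 by simp
    then show False using nofix by blast
  qed
  \<comment> \<open>A matrix of determinant 1 scaling by \<open>s\<^sup>2 = sqrt r\<close> has diagonal \<open>s\<close>, \<open>1 / s\<close>: hence a fourth root.\<close>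
  define s where "s = complex_of_real (sqrt (sqrt r))"
  have s0: "s \<noteq> 0" using \<open>r > 0\<close> by (simp add: s_def)
  have s4: "s ^ 4 = c\<^sup>2"
  proof -
    have "sqrt (sqrt r) ^ 4 = (sqrt (sqrt r) ^ 2) ^ 2" by (simp flip: power_mult)
    also have "\<dots> = r" using \<open>r > 0\<close> by simp
    finally show ?thesis unfolding s_def r of_real_power[symmetric] by simp
  qed
  define T where "T = moebius_map s (- s * w) 0 (1 / s)"
  have TM: "T \<in> Moebius"
    unfolding T_def Moebius_def using s0
    by (intro CollectI exI[of _ s] exI[of _ "- s * w"] exI[of _ 0] exI[of _ "1 / s"]) simp
  have T_fin: "T (Pt (w + z)) = Pt (s\<^sup>2 * z)" for z
    using s0 by (simp add: T_def proj_pt_def field_simps power2_eq_square)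
  have T_inf: "T Infty = Infty" by (simp add: T_def proj_pt_def)
  have "T \<circ> \<tau> = tau1 \<circ> T"
  proof
    fix x show "(T \<circ> \<tau>) x = (tau1 \<circ> T) x"
    proof (cases x)
      case Infty
      then show ?thesis using T_fin[of 0] by (simp add: tau_inf T_inf)
    next
      case (Pt y)
      define z where "z = y - w"
      have x: "x = Pt (w + z)" by (simp add: Pt z_def)
      show ?thesis
      proof (cases "z = 0")
        case True
        then show ?thesis using tau_fin[of 0] T_fin[of 0] by (simp add: x T_inf)
      next
        case False
        have "s\<^sup>2 * (- 1 / (c\<^sup>2 * cnj z)) = - 1 / cnj (s\<^sup>2 * z)"
          using s0 False unfolding s4[symmetric]
          by (simp add: s_def field_simps power2_eq_square power4_eq_xxxx)
        then show ?thesis using False s0 tau_fin[of z] T_fin[of z] T_fin[of "- 1 / (c\<^sup>2 * cnj z)"]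
          by (simp add: x)
      qed
    qed
  qed
  then have "conjugate_by T \<tau> = tau1" using conjugate_by_eq_iff[OF bij_Moebius[OF TM]] by blast
  then show ?thesis using that TM by blast
qed

lemma imaginary_reflection_inv_conjugate:
  assumes "T \<in> Moebius"
  shows "imaginary_reflection (inv T \<circ> tau1 \<circ> T)" "conjugate_by T (inv T \<circ> tau1 \<circ> T) = tau1"
proof -
  let ?Q = "inv T \<circ> tau1 \<circ> T"
  have T: "bij T" by (rule bij_Moebius[OF assms])
  have T1: "T (inv T x) = x" "inv T (T x) = x" for x
    using T by (simp_all add: bij_is_surj surj_f_inv_f bij_is_inj)
  have t: "tau1 \<in> Ext_Moebius" "tau1 (tau1 x) = x" "tau1 x \<noteq> x" for x
    using imaginary_reflection_tau1 by (auto simp: imaginary_reflection_def fun_eq_iff)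
  have "?Q \<in> Ext_Moebius"
    using assms t(1) by (intro Ext_Moebius_comp_right Ext_Moebius_comp_left Moebius_inv)
  moreover have "?Q x \<noteq> x" for x using t(3)[of "T x"] T1 by (metis comp_apply)
  moreover have "?Q \<circ> ?Q = id" by (simp add: fun_eq_iff T1 t(2))
  ultimately show "imaginary_reflection ?Q"
    unfolding imaginary_reflection_def by (metis id_apply)
  show "conjugate_by T ?Q = tau1" by (simp add: conjugate_by_def fun_eq_iff T1)
qed

section \<open>Rational maps commuting with the antipodal map\<close>

text \<open>
  The action of \<open>tau1\<close> on forms, made explicit by \<open>hom_form_twist\<close> below. In these terms a
  quotient is in normal form exactly if its denominator is the twist of its numerator.
\<close>

definition twist :: "nat \<Rightarrow> complex poly \<Rightarrow> complex poly" where
  "twist d p = nf_den d (coeff p)"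

lemma tau1_proj_pt:
  assumes "(u, v) \<noteq> (0, 0)"
  shows "tau1 (proj_pt u v) = proj_pt (cnj v) (- cnj u)"
  using assms by (auto simp: proj_pt_def)

lemma coeff_nf_num: "coeff (nf_num d a) k = (if k \<le> d then a k else 0)"
proof -
  have "coeff (nf_num d a) k = (\<Sum>j\<le>d. if j = k then a k else 0)"
    unfolding nf_num_def coeff_sum by (rule sum.cong) auto
  then show ?thesis by simp
qed

lemma coeff_nf_den: "coeff (nf_den d a) k = (if k \<le> d then (- 1) ^ k * cnj (a (d - k)) else 0)"
  unfolding nf_den_def coeff_nf_num[unfolded nf_num_def] by simp

lemma coeff_twist:
  "coeff (twist d p) k = (if k \<le> d then (- 1) ^ k * cnj (coeff p (d - k)) else 0)"
  unfolding twist_def by (rule coeff_nf_den)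

lemma degree_twist: "degree (twist d p) \<le> d"
  by (rule degree_le) (auto simp: coeff_twist)

text \<open>
  The sign is the source of the parity restriction: the antilinear lift of \<open>tau1\<close> to the plane
  squares to \<open>- 1\<close>, which acts on forms of degree \<open>d\<close> as \<open>(- 1) ^ d\<close>.
\<close>

lemma twist_twist:
  assumes "degree p \<le> d"
  shows "twist d (twist d p) = smult ((- 1) ^ d) p"
proof (rule poly_eqI)
  fix k
  show "coeff (twist d (twist d p)) k = coeff (smult ((- 1) ^ d) p) k"
  proof (cases "k \<le> d")
    case True
    have "(- 1 :: complex) ^ k * (- 1) ^ (d - k) = (- 1) ^ d"
      using True by (simp flip: power_add)
    then show ?thesis using True by (simp add: coeff_twist flip: mult.assoc)
  next
    case False
    then show ?thesis using assms by (simp add: coeff_twist coeff_eq_0)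
  qed
qed

lemma twist_smult: "twist d (smult c p) = smult (cnj c) (twist d p)"
  by (rule poly_eqI) (simp add: coeff_twist)

lemma hom_form_twist: "hom_form d (twist d p) u v = cnj (hom_form d p (cnj v) (- cnj u))"
proof -
  have "hom_form d (twist d p) u v
      = (\<Sum>k\<le>d. (- 1) ^ k * cnj (coeff p (d - k)) * u ^ k * v ^ (d - k))"
    unfolding hom_form_def by (rule sum.cong) (auto simp: coeff_twist)
  also have "\<dots> = (\<Sum>k\<le>d. (- 1) ^ (d - k) * cnj (coeff p k) * u ^ (d - k) * v ^ k)"
    by (subst sum.nat_diff_reindex[symmetric, where n = "Suc d", unfolded lessThan_Suc_atMost])
       (auto intro!: sum.cong)
  also have "\<dots> = cnj (hom_form d p (cnj v) (- cnj u))"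
    unfolding hom_form_def cnj_sum
  proof (rule sum.cong[OF refl])
    fix k
    show "(- 1) ^ (d - k) * cnj (coeff p k) * u ^ (d - k) * v ^ k
        = cnj (coeff p k * cnj v ^ k * (- cnj u) ^ (d - k))"
      by (simp add: power_minus[of u] mult_ac)
  qed
  finally show ?thesis .
qed

text \<open>
  With \<open>q = twist d p\<close> and \<open>d\<close> odd, also \<open>twist d q = - p\<close>. Thus precomposing \<open>[p : q]\<close> with
  \<open>tau1\<close> gives \<open>[cnj q : - cnj p]\<close>, which is what postcomposing with \<open>tau1\<close> gives.
\<close>

lemma normal_form_commutes_tau1:
  assumes "odd d" "normal_form d f"
  shows "conjugate_by tau1 f = f"
proof -
  obtain a where "is_rat_quotient d (nf_num d a) (nf_den d a) f"
    using assms(2) by (auto simp: normal_form_def)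
  moreover define p where "p = nf_num d a"
  moreover have "nf_den d a = twist d p"
    by (rule poly_eqI) (simp add: p_def coeff_twist coeff_nf_den coeff_nf_num)
  ultimately have r: "represents d p (twist d p) f"
    by (simp add: is_rat_quotient_iff_represents)
  then have deg: "degree p \<le> d" by (simp add: represents_def)
  have "tau1 \<circ> f = f \<circ> tau1"
  proof (rule sphere_map_eqI)
    fix u v :: complex assume uv: "(u, v) \<noteq> (0, 0)"
    let ?P = "hom_form d p u v" and ?Q = "hom_form d (twist d p) u v"
    have nz: "(?P, ?Q) \<noteq> (0, 0)" and f: "f (proj_pt u v) = proj_pt ?P ?Q"
      using r uv by (auto simp: represents_def)
    have "(cnj v, - cnj u) \<noteq> (0, 0)" using uv by auto
    then have "f (tau1 (proj_pt u v))
        = proj_pt (hom_form d p (cnj v) (- cnj u)) (hom_form d (twist d p) (cnj v) (- cnj u))"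
      using r by (simp add: tau1_proj_pt[OF uv] represents_def)
    also have "hom_form d p (cnj v) (- cnj u) = cnj ?Q"
      by (simp add: hom_form_twist)
    also have "hom_form d (twist d p) (cnj v) (- cnj u) = - cnj ?P"
    proof -
      have "cnj (hom_form d (twist d p) (cnj v) (- cnj u)) = - ?P"
        unfolding hom_form_twist[symmetric] twist_twist[OF deg] hom_form_smult
        using assms(1) by simp
      then show ?thesis by (metis complex_cnj_cnj complex_cnj_minus)
    qed
    finally show "(tau1 \<circ> f) (proj_pt u v) = (f \<circ> tau1) (proj_pt u v)"
      using tau1_proj_pt[OF nz] by (simp add: f)
  qed
  then show ?thesis by (simp add: conjugate_by_eq_iff[OF bij_tau1])
qed

text \<open>
  Commuting with \<open>tau1\<close> says that \<open>[twist d p : twist d q]\<close> and \<open>[- q : p]\<close> define the same map.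
  Since \<open>p\<close> and \<open>q\<close> are coprime, the two pairs differ by a polynomial factor, and since one of
  \<open>p\<close>, \<open>q\<close> has degree \<open>d\<close> while both twists have degree at most \<open>d\<close>, this factor is constant.
\<close>

lemma commutes_tau1_twist_proportional:
  assumes "d \<ge> 1" "represents d p q f" "conjugate_by tau1 f = f"
  obtains l where "twist d q = smult l p" "twist d p = smult (- l) q"
proof -
  have comm: "tau1 (f x) = f (tau1 x)" for x
    using assms(3) conjugate_by_eq_iff[OF bij_tau1, of f f] by (metis comp_apply)
  have cop: "coprime p q" and maxdeg: "max (degree p) (degree q) = d"
    using assms(2) unfolding is_rat_quotient_iff_represents[symmetric] is_rat_quotient_def by auto
  have degs: "degree p \<le> d" "degree q \<le> d" using maxdeg by auto
  have "poly (twist d p * p) z = poly (- (twist d q * q)) z" for z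
  proof -
    have z: "(z, 1) \<noteq> (0 :: complex, 0 :: complex)" and z': "(cnj 1, - cnj z) \<noteq> (0, 0)" by auto
    let ?P = "hom_form d p z 1" and ?Q = "hom_form d q z 1"
    let ?P' = "hom_form d p (cnj 1) (- cnj z)" and ?Q' = "hom_form d q (cnj 1) (- cnj z)"
    have nz: "(?P, ?Q) \<noteq> (0, 0)" "(?P', ?Q') \<noteq> (0, 0)"
      using assms(2) z z' unfolding represents_def by blast+
    have f: "f (proj_pt z 1) = proj_pt ?P ?Q" "f (proj_pt (cnj 1) (- cnj z)) = proj_pt ?P' ?Q'"
      using assms(2) z z' unfolding represents_def by blast+
    have "proj_pt (cnj ?Q) (- cnj ?P) = proj_pt ?P' ?Q'"
      using comm[of "proj_pt z 1"] unfolding tau1_proj_pt[OF z] f tau1_proj_pt[OF nz(1)] .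
    moreover have "(cnj ?Q, - cnj ?P) \<noteq> (0, 0)" using nz(1) by auto
    ultimately have "cnj ?Q * ?Q' = ?P' * (- cnj ?P)" using proj_pt_eq_iff nz(2) by blast
    then have "cnj (cnj ?Q * ?Q') = cnj (?P' * (- cnj ?P))" by (rule arg_cong)
    then have "?Q * cnj ?Q' = - (cnj ?P' * ?P)" by simp
    then have "?Q * hom_form d (twist d q) z 1 = - (hom_form d (twist d p) z 1 * ?P)"
      unfolding hom_form_twist .
    then show ?thesis by (simp add: hom_form_finite degs degree_twist mult_ac)
  qed
  then have eq: "twist d p * p = - (twist d q * q)" by (metis poly_eq_poly_eq_iff ext)
  have unit_deg: "degree r = 0" if "is_unit r" for r :: "complex poly"
    using that by (metis is_unit_iff_degree not_is_unit_0)
  have p0: "p \<noteq> 0" and q0: "q \<noteq> 0" using cop maxdeg assms(1) unit_deg by auto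
  have "p dvd twist d q * q" using eq by (metis dvd_minus_iff dvd_triv_right)
  then have "p dvd twist d q" using coprime_dvd_mult_left_iff[OF cop] by simp
  then obtain m where m: "twist d q = p * m" by (elim dvdE)
  have "p * twist d p = p * - (m * q)" using eq by (simp add: m algebra_simps)
  then have m': "twist d p = - (m * q)" by (rule mult_left_cancel[OF p0, THEN iffD1])
  have "degree m = 0"
  proof (cases "m = 0")
    case False
    have "degree p + degree m \<le> d" "degree m + degree q \<le> d"
      using degree_twist[of d q] degree_twist[of d p] False p0 q0
      by (simp_all add: m m' degree_mult_eq)
    then show ?thesis using maxdeg by auto
  qed simp
  then obtain l where "m = [:l:]" by (elim degree_eq_zeroE)
  then show ?thesis using m m' that by simp
qed

text \<open>
  Comparing \<open>twist d (twist d p) = (- 1) ^ d p\<close> with the proportionality constant \<open>l\<close> forces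
  \<open>(- 1) ^ d = - (cmod l)\<^sup>2\<close>; a rescaling of the fraction then removes \<open>l\<close>.
\<close>

lemma commutes_tau1_imp_normal_form:
  assumes "d \<ge> 1" "f \<in> Rat d" "conjugate_by tau1 f = f"
  shows "odd d" "normal_form d f"
proof -
  obtain p q where r: "represents d p q f"
    using assms(2) by (auto simp: Rat_def is_rat_quotient_iff_represents)
  have cop: "coprime p q" and maxdeg: "max (degree p) (degree q) = d"
    using r unfolding is_rat_quotient_iff_represents[symmetric] is_rat_quotient_def by auto
  have degs: "degree p \<le> d" "degree q \<le> d" using maxdeg by auto
  have p0: "p \<noteq> 0"
    using cop maxdeg assms(1) is_unit_iff_degree[of q] by (cases "q = 0") auto
  obtain l where l: "twist d q = smult l p" "twist d p = smult (- l) q"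
    using commutes_tau1_twist_proportional[OF assms(1) r assms(3)] .
  have "smult ((- 1) ^ d) p = smult (- (cnj l * l)) p"
    unfolding twist_twist[OF degs(1), symmetric] l(2) twist_smult l(1) by simp
  then have "((- 1) ^ d :: complex) = - (cnj l * l)"
    using p0 by (metis coeff_smult leading_coeff_0_iff mult_right_cancel)
  also have "cnj l * l = complex_of_real ((cmod l)\<^sup>2)"
    using complex_norm_square[of l] by (simp add: mult.commute)
  finally have "complex_of_real ((- 1) ^ d) = complex_of_real (- ((cmod l)\<^sup>2))" by simp
  then have sq: "(- 1) ^ d = - ((cmod l)\<^sup>2)" by (simp only: of_real_eq_iff)
  show odd: "odd d"
  proof
    assume "even d"
    then have "(cmod l)\<^sup>2 = - 1" using sq by simp
    then show False using zero_le_power2[of "cmod l"] by linarith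
  qed
  then have "(cmod l)\<^sup>2 = 1" using sq by simp
  then have norm_l: "cmod l = 1" by (simp add: power2_eq_1_iff) (use norm_ge_zero[of l] in linarith)
  \<comment> \<open>Scaling by a unimodular \<open>\<mu>\<close> turns \<open>twist d p = - l q\<close> into
      \<open>twist d (\<mu> p) = - (cnj \<mu> * l) q\<close>, which equals \<open>\<mu> q\<close> if \<open>\<mu>\<^sup>2 = - l\<close>.\<close>
  define \<mu> where "\<mu> = csqrt (- l)"
  have mu2: "\<mu> * \<mu> = - l" unfolding \<mu>_def by (metis power2_csqrt power2_eq_square)
  have "cmod \<mu> ^ 2 = 1" using mu2 norm_l by (metis norm_minus_cancel norm_mult power2_eq_square)
  then have mu_unit: "cnj \<mu> * \<mu> = 1" using complex_norm_square[of \<mu>] by (simp add: mult.commute)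
  have mu0: "\<mu> \<noteq> 0" using mu_unit by auto
  have num: "nf_num d (coeff (smult \<mu> p)) = smult \<mu> p"
    by (rule poly_eqI) (use degs in \<open>auto simp: coeff_nf_num coeff_eq_0\<close>)
  have "nf_den d (coeff (smult \<mu> p)) = smult (cnj \<mu>) (twist d p)"
    by (simp flip: twist_def twist_smult)
  also have "\<dots> = smult (cnj \<mu> * \<mu> * \<mu>) q" by (simp add: l mu2 mult.assoc)
  finally have den: "nf_den d (coeff (smult \<mu> p)) = smult \<mu> q" by (simp add: mu_unit)
  have "represents d (smult \<mu> p) (smult \<mu> q) f"
    using r mu0 by (simp add: represents_def hom_form_smult proj_pt_scale)
  then have "is_rat_quotient d (nf_num d (coeff (smult \<mu> p))) (nf_den d (coeff (smult \<mu> p))) f"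
    by (simp add: num den is_rat_quotient_iff_represents del: coeff_smult)
  then show "normal_form d f" unfolding normal_form_def by blast
qed

section \<open>The classification\<close>

lemma antihol_automorphism_iff_commutes_tau1:
  assumes "imaginary_reflection \<tau>" "T \<in> Moebius" "conjugate_by T \<tau> = tau1"
  shows "antihol_automorphism \<tau> \<phi> \<longleftrightarrow> conjugate_by tau1 (conjugate_by T \<phi>) = conjugate_by T \<phi>"
proof -
  have "\<tau> \<in> Ext_Moebius" using assms(1) by (simp add: imaginary_reflection_def)
  then show ?thesis
    using conjugation_preserves_commuting[OF bij_Moebius bij_Ext_Moebius bij_tau1] assms
    by (simp add: antihol_automorphism_def)
qed

theorem theorem2:
  fixes d :: nat
  assumes "d \<ge> 2"
  shows "(\<forall>\<phi> \<in> Rat d.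
           (\<exists>\<tau>. imaginary_reflection \<tau> \<and> antihol_automorphism \<tau> \<phi>) \<longrightarrow> odd d) \<and>
         (odd d \<longrightarrow> (\<forall>\<phi> \<in> Rat d.
           ((\<exists>\<tau>. imaginary_reflection \<tau> \<and> antihol_automorphism \<tau> \<phi>) \<longleftrightarrow>
            (\<exists>T \<in> Moebius. normal_form d (conjugate_by T \<phi>))) \<and>
           (\<forall>\<tau>. imaginary_reflection \<tau> \<longrightarrow>
              (antihol_automorphism \<tau> \<phi> \<longleftrightarrow>
               (\<exists>T \<in> Moebius. conjugate_by T \<tau> = tau1 \<and> normal_form d (conjugate_by T \<phi>))))))"
proof -
  have d1: "d \<ge> 1" using assms by simp
  have fwd: "odd d \<and> (\<exists>T \<in> Moebius. conjugate_by T \<tau> = tau1 \<and> normal_form d (conjugate_by T \<phi>))"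
    if \<phi>: "\<phi> \<in> Rat d" and \<tau>: "imaginary_reflection \<tau>" "antihol_automorphism \<tau> \<phi>" for \<phi> \<tau>
  proof -
    obtain T where T: "T \<in> Moebius" "conjugate_by T \<tau> = tau1"
      using imaginary_reflection_conjugate_tau1[OF \<tau>(1)] .
    have "conjugate_by tau1 (conjugate_by T \<phi>) = conjugate_by T \<phi>"
      using antihol_automorphism_iff_commutes_tau1[OF \<tau>(1) T] \<tau>(2) by blast
    then show ?thesis
      using commutes_tau1_imp_normal_form[OF d1 Rat_conjugate_by[OF T(1) \<phi>]] T by blast
  qed
  have bwd: "antihol_automorphism \<tau> \<phi>"
    if "odd d" "imaginary_reflection \<tau>" "T \<in> Moebius" "conjugate_by T \<tau> = tau1"
      "normal_form d (conjugate_by T \<phi>)" for \<phi> \<tau> T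
    using antihol_automorphism_iff_commutes_tau1[OF that(2-4)]
      normal_form_commutes_tau1[OF that(1,5)] by blast
  have "\<exists>\<tau>. imaginary_reflection \<tau> \<and> antihol_automorphism \<tau> \<phi>"
    if "odd d" "T \<in> Moebius" "normal_form d (conjugate_by T \<phi>)" for \<phi> T
    using bwd[OF that(1) imaginary_reflection_inv_conjugate(1)[OF that(2)] that(2)
        imaginary_reflection_inv_conjugate(2)[OF that(2)] that(3)]
      imaginary_reflection_inv_conjugate(1)[OF that(2)] by blast
  then show ?thesis using fwd bwd by blast
qed

end
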